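(* Let $\mathbb{H}_1, \mathbb{H}_2$ be Hilbert spaces over the same field $\mathbb{K}\in\{\mathbb{R},\mathbb{C}\}$ and let $T:\mathbb{H}_1\to\mathbb{H}_2$ be a bounded linear operator. Let $x\in\mathbb{H}_1$ with $\|x\|=1$. Then $x\in M_T$ if and only if both of the following conditions are satisfied: (i) for every $y\in\mathbb{H}_1$, $\langle x,y\rangle=0$ implies $\langle Tx,Ty\rangle=0$; (ii) $\sup\{\|Ty\| : y\in\mathbb{H}_1,\ \|y\|=1,\ \langle x,y\rangle=0\}\le\|Tx\|$.
   Context: For a bounded linear operator $T$ between normed spaces $\mathbb{X}$ and $\mathbb{Y}$, the norm attainment set is $M_T=\{x\in\mathbb{X} : \|x\|=1,\ \|Tx\|=\|T\|\}$, where $\|T\|$ is the operator norm. If the set in (ii) is empty (which happens when $\dim\mathbb{H}_1=1$), condition (ii) is regarded as satisfied. *)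

theory Defs
  imports "HOL-Analysis.Analysis"
begin

text \<open>
  Real Hilbert spaces are the library types of sort \<open>{real_inner, complete_space}\<close>.  Complex Hilbert
  spaces are not in the library.  They are introduced here as a class on top of
  \<^class>\<open>real_normed_vector\<close>, so that \<^const>\<open>bounded_linear\<close>, \<^const>\<open>onorm\<close> and the topology
  are the library's own; the underlying real structure is restriction of scalars.
\<close>

class complex_vector = real_vector +
  fixes scaleC :: "complex \<Rightarrow> 'a \<Rightarrow> 'a"  (infixr "*\<^sub>C" 75)
  assumes scaleC_add_right: "a *\<^sub>C (x + y) = a *\<^sub>C x + a *\<^sub>C y"
    and scaleC_add_left: "(a + b) *\<^sub>C x = a *\<^sub>C x + b *\<^sub>C x"
    and scaleC_scaleC: "a *\<^sub>C (b *\<^sub>C x) = (a * b) *\<^sub>C x"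
    and scaleC_one: "1 *\<^sub>C x = x"
    and scaleC_of_real: "complex_of_real r *\<^sub>C x = r *\<^sub>R x"

text \<open>The inner product is linear in the first argument and conjugate-linear in the second.\<close>

class complex_inner = complex_vector + real_normed_vector +
  fixes cinner :: "'a \<Rightarrow> 'a \<Rightarrow> complex"
  assumes cinner_commute: "cinner x y = cnj (cinner y x)"
    and cinner_add_left: "cinner (x + y) z = cinner x z + cinner y z"
    and cinner_scaleC_left: "cinner (a *\<^sub>C x) y = a * cinner x y"
    and cinner_ge_zero: "0 \<le> Re (cinner x x)"
    and cinner_eq_zero_iff: "cinner x x = 0 \<longleftrightarrow> x = 0"
    and norm_eq_sqrt_cinner: "norm x = sqrt (Re (cinner x x))"

class complex_hilbert_space = complex_inner + complete_space

instantiation complex :: complex_hilbert_space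
begin

definition scaleC_complex :: "complex \<Rightarrow> complex \<Rightarrow> complex"
  where "scaleC_complex a x = a * x"

definition cinner_complex :: "complex \<Rightarrow> complex \<Rightarrow> complex"
  where "cinner_complex x y = x * cnj y"

instance
  by standard
    (auto simp: scaleC_complex_def cinner_complex_def algebra_simps scaleR_conv_of_real
      cmod_def power2_eq_square)

end

definition bounded_clinear :: "('a::complex_inner \<Rightarrow> 'b::complex_inner) \<Rightarrow> bool"
  where "bounded_clinear T \<longleftrightarrow> bounded_linear T \<and> (\<forall>c x. T (c *\<^sub>C x) = c *\<^sub>C T x)"

definition norm_attainment_set :: "('a::real_normed_vector \<Rightarrow> 'b::real_normed_vector) \<Rightarrow> 'a set"
  where "norm_attainment_set T = {x. norm x = 1 \<and> norm (T x) = onorm T}"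

end

theory Submission
  imports Defs
begin

text \<open>
  If \<open>x\<close> attains the norm and \<open>y\<close> is orthogonal to \<open>x\<close>, then
  \<open>norm (T (x + t y))^2 \<le> onorm T^2 * (1 + t^2 * norm y^2)\<close> for all real \<open>t\<close>; comparing the terms of
  first order in \<open>t\<close> gives \<open>Re \<langle>T x, T y\<rangle> = 0\<close>, and over the complex numbers replacing \<open>y\<close> by \<open>\<i> y\<close>
  removes the imaginary part.  Conversely, under the two conditions the Pythagorean theorem applies
  both to the decomposition of \<open>z\<close> along \<open>x\<close> and to its image, so
  \<open>norm (T z) \<le> norm (T x) * norm z\<close>.
\<close>

section \<open>Norm estimates common to both scalar fields\<close>

lemma linear_le_quadratic_imp_zero:
  fixes c k :: real
  assumes "\<And>t. t * c \<le> t\<^sup>2 * k"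
  shows "c = 0"
proof (rule ccontr)
  assume c: "c \<noteq> 0"
  \<comment> \<open>Dividing by \<open>\<bar>k\<bar> + 1\<close> keeps the denominator positive and
    makes \<open>t * c\<close> equal to \<open>t\<^sup>2 * (\<bar>k\<bar> + 1)\<close>, which
    strictly exceeds \<open>t\<^sup>2 * k\<close>; this single \<open>t\<close> replaces a limit at
    0.\<close>
  define t where "t = c / (\<bar>k\<bar> + 1)"
  have c_eq: "c = t * (\<bar>k\<bar> + 1)" by (simp add: t_def)
  have "t \<noteq> 0" using c c_eq by auto
  then have "t\<^sup>2 * k < t\<^sup>2 * (\<bar>k\<bar> + 1)" by (intro mult_strict_left_mono) auto
  also have "\<dots> = t * c" by (simp add: c_eq power2_eq_square mult.assoc)
  also have "\<dots> \<le> t\<^sup>2 * k" by (rule assms)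
  finally show False by simp
qed

text \<open>Serves both fields: \<open>c\<close> stands for the real part of the inner product of
  \<open>T x\<close> and \<open>T y\<close>, \<open>dom\<close> is Pythagoras for \<open>y\<close>
  orthogonal to \<open>x\<close>, and \<open>cod\<close> is the expansion of the squared norm in the
  codomain.\<close>

lemma first_order_term_zero_if_norm_attained:
  assumes T: "bounded_linear T" and x: "norm x = 1" and att: "norm (T x) = onorm T"
    and dom: "\<And>t. (norm (x + t *\<^sub>R y))\<^sup>2 = 1 + t\<^sup>2 * (norm y)\<^sup>2"
    and cod: "\<And>t. (norm (T x + t *\<^sub>R T y))\<^sup>2 = (norm (T x))\<^sup>2 + 2 * t * c + t\<^sup>2 * (norm (T y))\<^sup>2"
  shows "c = 0"
proof (rule linear_le_quadratic_imp_zero)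
  fix t :: real
  interpret T: bounded_linear T by (rule T)
  have "norm (T (x + t *\<^sub>R y)) \<le> onorm T * norm (x + t *\<^sub>R y)"
    by (rule onorm[OF T])
  then have "(norm (T x + t *\<^sub>R T y))\<^sup>2 \<le> (onorm T)\<^sup>2 * (norm (x + t *\<^sub>R y))\<^sup>2"
    by (metis T.add T.scale norm_ge_zero power_mono power_mult_distrib)
  \<comment> \<open>By \<open>att\<close> the constant terms on the two sides are both
    \<open>(onorm T)\<^sup>2\<close> and cancel.\<close>
  then have "2 * t * c + t\<^sup>2 * (norm (T y))\<^sup>2 \<le> t\<^sup>2 * ((onorm T)\<^sup>2 * (norm y)\<^sup>2)"
    unfolding dom cod att by (simp add: algebra_simps)
  moreover have "0 \<le> t\<^sup>2 * (norm (T y))\<^sup>2" by simp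
  ultimately have "2 * (t * c) \<le> t\<^sup>2 * ((onorm T)\<^sup>2 * (norm y)\<^sup>2)" by linarith
  then show "t * c \<le> t\<^sup>2 * ((onorm T)\<^sup>2 * (norm y)\<^sup>2 / 2)"
    by simp
qed

text \<open>Homogeneity trades condition (ii) for a bound without a supremum: a nonzero vector
  satisfying \<open>P\<close> can be normalized within \<open>P\<close>. If no unit vector satisfies
  \<open>P\<close>, then at most 0 does, and the bound is trivial.\<close>

lemma Sup_norm_unit_le_iff:
  assumes T: "bounded_linear T" and P: "\<And>r y. P y \<Longrightarrow> P (r *\<^sub>R y)"
  shows "({y. norm y = 1 \<and> P y} = {} \<or> Sup {norm (T y) | y. norm y = 1 \<and> P y} \<le> c)
    \<longleftrightarrow> (\<forall>y. P y \<longrightarrow> norm (T y) \<le> c * norm y)"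
    (is "?E = {} \<or> Sup ?S \<le> c \<longleftrightarrow> ?R")
proof
  interpret T: bounded_linear T by (rule T)
  assume L: "?E = {} \<or> Sup ?S \<le> c"
  have bdd: "bdd_above ?S"
    by (rule bdd_aboveI[of _ "onorm T"]) (clarsimp, metis onorm[OF T] mult_1_right)
  show ?R
  proof (intro allI impI)
    fix y assume y: "P y"
    show "norm (T y) \<le> c * norm y"
    proof (cases "y = 0")
      case False
      define u where "u = inverse (norm y) *\<^sub>R y"
      have u: "norm u = 1" "P u" and yu: "y = norm y *\<^sub>R u"
        using False y by (auto simp: u_def intro: P)
      then have "norm (T u) \<le> Sup ?S"
        by (intro cSup_upper bdd) auto
      \<comment> \<open>The vector \<open>u\<close> excludes the empty alternative in
        \<open>L\<close>.\<close>
      with L u have "norm (T u) \<le> c" by auto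
      moreover have "norm (T y) = norm y * norm (T u)"
        by (subst yu) (simp add: T.scale)
      ultimately show ?thesis
        by (simp add: mult.commute[of c] mult_left_mono)
    qed simp
  qed
next
  assume R: ?R
  show "?E = {} \<or> Sup ?S \<le> c"
  proof (cases "?E = {}")
    case False
    then have "Sup ?S \<le> c" by (intro cSup_least) (use R in force)+
    then show ?thesis ..
  qed simp
qed

text \<open>Here \<open>w\<close> is meant as the component of \<open>z\<close> along
  \<open>x\<close>, and \<open>P\<close> as orthogonality to \<open>x\<close>. \<open>T\<close>
  stretches \<open>w\<close> by exactly \<open>norm (T x)\<close> and \<open>y\<close> by at most
  that factor, so the squared estimates add up.\<close>

lemma norm_attained_if_pythagorean_decomposition:
  assumes T: "bounded_linear T" and x: "norm x = 1"
    and bound: "\<And>y. P y \<Longrightarrow> norm (T y) \<le> norm (T x) * norm y"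
    and decomp: "\<And>z. \<exists>w y. z = w + y \<and> P y \<and> norm (T w) = norm (T x) * norm w
      \<and> (norm z)\<^sup>2 = (norm w)\<^sup>2 + (norm y)\<^sup>2 \<and> (norm (T z))\<^sup>2 = (norm (T w))\<^sup>2 + (norm (T y))\<^sup>2"
  shows "norm (T x) = onorm T"
proof (rule antisym)
  show "norm (T x) \<le> onorm T" using onorm[OF T, of x] x by simp
  show "onorm T \<le> norm (T x)"
  proof (rule onorm_bound)
    fix z
    obtain w y where P: "P y" and w: "norm (T w) = norm (T x) * norm w"
      and z: "(norm z)\<^sup>2 = (norm w)\<^sup>2 + (norm y)\<^sup>2"
      and Tz: "(norm (T z))\<^sup>2 = (norm (T w))\<^sup>2 + (norm (T y))\<^sup>2"
      using decomp[of z] by blast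
    have "(norm (T z))\<^sup>2 \<le> (norm (T x) * norm w)\<^sup>2 + (norm (T x) * norm y)\<^sup>2"
      unfolding Tz w by (intro add_left_mono power_mono bound P) simp
    also have "\<dots> = (norm (T x) * norm z)\<^sup>2"
      by (simp add: power_mult_distrib z distrib_left)
    finally show "norm (T z) \<le> norm (T x) * norm z"
      by (rule power2_le_imp_le) simp
  qed simp
qed

section \<open>Real inner product spaces\<close>

lemma norm_add_power2_inner:
  fixes x y :: "'a::real_inner"
  shows "(norm (x + y))\<^sup>2 = (norm x)\<^sup>2 + 2 * inner x y + (norm y)\<^sup>2"
  by (simp add: power2_norm_eq_inner inner_add inner_commute)

lemma norm_attainment_set_iff_real:
  fixes T :: "'a::real_inner \<Rightarrow> 'b::real_inner"
  assumes T: "bounded_linear T" and x: "norm x = 1"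
  shows "x \<in> norm_attainment_set T \<longleftrightarrow>
    (\<forall>y. inner x y = 0 \<longrightarrow> inner (T x) (T y) = 0) \<and>
    ({y. norm y = 1 \<and> inner x y = 0} = {} \<or>
     Sup {norm (T y) | y. norm y = 1 \<and> inner x y = 0} \<le> norm (T x))"
proof -
  interpret T: bounded_linear T by (rule T)
  have sup: "({y. norm y = 1 \<and> inner x y = 0} = {} \<or>
      Sup {norm (T y) | y. norm y = 1 \<and> inner x y = 0} \<le> norm (T x))
    \<longleftrightarrow> (\<forall>y. inner x y = 0 \<longrightarrow> norm (T y) \<le> norm (T x) * norm y)"
    by (rule Sup_norm_unit_le_iff[OF T]) simp
  show ?thesis
    unfolding sup
  proof (intro iffI conjI allI impI; (elim conjE)?)
    fix y assume att: "x \<in> norm_attainment_set T" and y: "inner x y = 0"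
    then show "inner (T x) (T y) = 0"
      by (intro first_order_term_zero_if_norm_attained[OF T x, of y])
        (simp_all add: norm_attainment_set_def norm_add_power2_inner power_mult_distrib)
    show "norm (T y) \<le> norm (T x) * norm y"
      using att onorm[OF T, of y] by (simp add: norm_attainment_set_def)
  next
    assume orth: "\<forall>y. inner x y = 0 \<longrightarrow> inner (T x) (T y) = 0"
      and bound: "\<forall>y. inner x y = 0 \<longrightarrow> norm (T y) \<le> norm (T x) * norm y"
    have "norm (T x) = onorm T"
    proof (rule norm_attained_if_pythagorean_decomposition[OF T x, of "\<lambda>y. inner x y = 0"])
      fix z
      define a where "a = inner x z"
      define y where "y = z - a *\<^sub>R x"
      have z: "z = a *\<^sub>R x + y" by (simp add: y_def)
      have y: "inner x y = 0"
        using x by (simp add: y_def a_def inner_diff_right norm_eq_1)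
      moreover have "inner (T x) (T y) = 0" using orth y by blast
      \<comment> \<open>Both cross terms vanish: \<open>y\<close> is orthogonal to \<open>x\<close>,
        and \<open>T y\<close> to \<open>T x\<close>.\<close>
      ultimately show "\<exists>w y. z = w + y \<and> inner x y = 0 \<and> norm (T w) = norm (T x) * norm w
        \<and> (norm z)\<^sup>2 = (norm w)\<^sup>2 + (norm y)\<^sup>2 \<and> (norm (T z))\<^sup>2 = (norm (T w))\<^sup>2 + (norm (T y))\<^sup>2"
        using x z
        by (intro exI[of _ "a *\<^sub>R x"] exI[of _ y])
          (simp add: norm_add_power2_inner T.add T.scale)
    qed (use bound in blast)
    then show "x \<in> norm_attainment_set T" using x by (simp add: norm_attainment_set_def)
  qed
qed

section \<open>Complex inner product spaces\<close>

lemma cinner_add_right: "cinner x (y + z) = cinner x y + cinner x z"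
  by (metis cinner_add_left cinner_commute complex_cnj_add)

lemma cinner_scaleC_right: "cinner x (a *\<^sub>C y) = cnj a * cinner x y"
  by (metis cinner_commute cinner_scaleC_left complex_cnj_mult)

lemma cinner_scaleR_right: "cinner x (r *\<^sub>R y) = complex_of_real r * cinner x y"
  by (simp add: cinner_scaleC_right flip: scaleC_of_real)

lemma cinner_self: "cinner x x = complex_of_real ((norm x)\<^sup>2)"
proof (rule complex_eqI)
  show "Re (cinner x x) = Re (complex_of_real ((norm x)\<^sup>2))"
    by (simp add: norm_eq_sqrt_cinner cinner_ge_zero)
  show "Im (cinner x x) = Im (complex_of_real ((norm x)\<^sup>2))"
    using arg_cong[OF cinner_commute[of x x], of Im] by simp
qed

lemma norm_add_power2_cinner:
  "(norm (x + y))\<^sup>2 = (norm x)\<^sup>2 + 2 * Re (cinner x y) + (norm y)\<^sup>2"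
proof -
  have "Re (cinner y x) = Re (cinner x y)"
    by (subst cinner_commute) simp
  then have "Re (cinner (x + y) (x + y))
      = Re (cinner x x) + 2 * Re (cinner x y) + Re (cinner y y)"
    by (simp add: cinner_add_left cinner_add_right)
  then show ?thesis by (simp only: cinner_self Re_complex_of_real)
qed

text \<open>The class axioms give homogeneity of the norm for real scalars only; for complex ones it
  comes from the inner product.\<close>

lemma norm_scaleC: "norm (a *\<^sub>C x) = cmod a * norm x" for x :: "'a::complex_inner"
proof -
  have "complex_of_real ((norm (a *\<^sub>C x))\<^sup>2) = a * cnj a * cinner x x"
    unfolding cinner_self[symmetric] by (simp add: cinner_scaleC_left cinner_scaleC_right)
  also have "\<dots> = complex_of_real ((cmod a * norm x)\<^sup>2)"
    by (simp add: cinner_self power_mult_distrib flip: complex_norm_square)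
  finally have "(norm (a *\<^sub>C x))\<^sup>2 = (cmod a * norm x)\<^sup>2"
    by (simp only: of_real_eq_iff)
  then show ?thesis by (simp add: power2_eq_iff_nonneg)
qed

lemma norm_attainment_set_iff_complex:
  fixes T :: "'a::complex_inner \<Rightarrow> 'b::complex_inner"
  assumes T: "bounded_clinear T" and x: "norm x = 1"
  shows "x \<in> norm_attainment_set T \<longleftrightarrow>
    (\<forall>y. cinner x y = 0 \<longrightarrow> cinner (T x) (T y) = 0) \<and>
    ({y. norm y = 1 \<and> cinner x y = 0} = {} \<or>
     Sup {norm (T y) | y. norm y = 1 \<and> cinner x y = 0} \<le> norm (T x))"
proof -
  have bl: "bounded_linear T" and scale: "T (c *\<^sub>C y) = c *\<^sub>C T y" for c y
    using T by (auto simp: bounded_clinear_def)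
  interpret T: bounded_linear T by (rule bl)
  have sup: "({y. norm y = 1 \<and> cinner x y = 0} = {} \<or>
      Sup {norm (T y) | y. norm y = 1 \<and> cinner x y = 0} \<le> norm (T x))
    \<longleftrightarrow> (\<forall>y. cinner x y = 0 \<longrightarrow> norm (T y) \<le> norm (T x) * norm y)"
    by (rule Sup_norm_unit_le_iff[OF bl]) (simp add: cinner_scaleR_right)
  show ?thesis
    unfolding sup
  proof (intro iffI conjI allI impI; (elim conjE)?)
    fix y assume att: "x \<in> norm_attainment_set T" and y: "cinner x y = 0"
    \<comment> \<open>With real \<open>t\<close>, the first-order term sees only the real part. The
      claim is for general \<open>v\<close> so that it applies to both \<open>y\<close> and
      \<open>\<i> *\<^sub>C y\<close>.\<close>
    have Re_0: "Re (cinner (T x) (T v)) = 0" if "cinner x v = 0" for v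
      using att that
      by (intro first_order_term_zero_if_norm_attained[OF bl x, of v])
        (simp_all add: norm_attainment_set_def norm_add_power2_cinner power_mult_distrib
          cinner_scaleR_right x)
    \<comment> \<open>Conjugate-linearity in the second argument pulls out the factor -i, so this
      real part is the imaginary part of \<open>cinner (T x) (T y)\<close>.\<close>
    have "Re (cinner (T x) (T (\<i> *\<^sub>C y))) = 0"
      by (rule Re_0) (simp add: cinner_scaleC_right y)
    then show "cinner (T x) (T y) = 0"
      using Re_0[OF y] by (simp add: scale cinner_scaleC_right complex_eq_iff)
    show "norm (T y) \<le> norm (T x) * norm y"
      using att onorm[OF bl, of y] by (simp add: norm_attainment_set_def)
  next
    assume orth: "\<forall>y. cinner x y = 0 \<longrightarrow> cinner (T x) (T y) = 0"
      and bound: "\<forall>y. cinner x y = 0 \<longrightarrow> norm (T y) \<le> norm (T x) * norm y"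
    have "norm (T x) = onorm T"
    proof (rule norm_attained_if_pythagorean_decomposition[OF bl x, of "\<lambda>y. cinner x y = 0"])
      fix z
      \<comment> \<open>The order of arguments matters: \<open>cinner x (a *\<^sub>C x)\<close> is
        \<open>cnj a\<close>, which equals \<open>cinner x z\<close> only for this choice.\<close>
      define a where "a = cinner z x"
      define y where "y = z - a *\<^sub>C x"
      have z: "z = a *\<^sub>C x + y" by (simp add: y_def)
      have "cnj a = cnj a + cinner x y"
        using arg_cong[OF z, of "cinner x"] x
        by (simp add: a_def cinner_add_right cinner_scaleC_right cinner_self flip: cinner_commute)
      then have y: "cinner x y = 0" by simp
      moreover have "cinner (T x) (T y) = 0" using orth y by blast
      ultimately show "\<exists>w y. z = w + y \<and> cinner x y = 0 \<and> norm (T w) = norm (T x) * norm w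
        \<and> (norm z)\<^sup>2 = (norm w)\<^sup>2 + (norm y)\<^sup>2 \<and> (norm (T z))\<^sup>2 = (norm (T w))\<^sup>2 + (norm (T y))\<^sup>2"
        using x z
        by (intro exI[of _ "a *\<^sub>C x"] exI[of _ y])
          (simp add: norm_add_power2_cinner T.add scale norm_scaleC cinner_scaleC_left)
    qed (use bound in blast)
    then show "x \<in> norm_attainment_set T" using x by (simp add: norm_attainment_set_def)
  qed
qed

theorem theorem2p1:
  shows
    \<comment> \<open>scalar field \<open>\<real>\<close>\<close>
    "(\<forall>(T :: 'a::{real_inner, complete_space} \<Rightarrow> 'b::{real_inner, complete_space}) x.
        bounded_linear T \<longrightarrow> norm x = 1 \<longrightarrow>
        (x \<in> norm_attainment_set T \<longleftrightarrow>
          (\<forall>y. inner x y = 0 \<longrightarrow> inner (T x) (T y) = 0) \<and>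
          ({y. norm y = 1 \<and> inner x y = 0} = {} \<or>
           Sup {norm (T y) | y. norm y = 1 \<and> inner x y = 0} \<le> norm (T x))))
     \<and>
     (\<forall>(T :: 'c::complex_hilbert_space \<Rightarrow> 'd::complex_hilbert_space) x.
        bounded_clinear T \<longrightarrow> norm x = 1 \<longrightarrow>
        (x \<in> norm_attainment_set T \<longleftrightarrow>
          (\<forall>y. cinner x y = 0 \<longrightarrow> cinner (T x) (T y) = 0) \<and>
          ({y. norm y = 1 \<and> cinner x y = 0} = {} \<or>
           Sup {norm (T y) | y. norm y = 1 \<and> cinner x y = 0} \<le> norm (T x))))"
  using norm_attainment_set_iff_real norm_attainment_set_iff_complex by blast

end
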